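(* For $\alpha\in[0,1]$ let $$f_\alpha(z)=\sum_{n=0}^\infty e^{2\pi i n^2\alpha}\,\frac{z^n}{n!}.$$ There is a residual set $E\subset[0,1]$ such that for every $\alpha\in E$, $$\limsup_{r\to\infty}\frac{M(r,f_\alpha)}{m_2(r,f_\alpha)}=\infty .$$
   Context: For an entire function $f$ and $r>0$, $M(r,f)=\max_{|z|=r}|f(z)|$ and $m_2(r,f)\ge 0$ is defined by $m_2^2(r,f)=\frac{1}{2\pi}\int_{-\pi}^{\pi}|f(re^{i\theta})|^2\,d\theta$. A set is called residual if it is an intersection of countably many dense open sets (here, dense relatively open subsets of $[0,1]$). *)

theory Defs
  imports "HOL-Analysis.Analysis"
begin

definition f_alpha :: "real \<Rightarrow> complex \<Rightarrow> complex" where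
  "f_alpha \<alpha> z = (\<Sum>n. exp (2 * of_real pi * \<i> * of_nat n ^ 2 * of_real \<alpha>) * (z ^ n / fact n))"

lemma summable_f_alpha:
  "summable (\<lambda>n. exp (2 * of_real pi * \<i> * of_nat n ^ 2 * of_real \<alpha>) * (z ^ n / fact n))"
proof (rule summable_comparison_test)
  show "summable (\<lambda>n. norm z ^ n / fact n)"
    using summable_exp[of "norm z"] by (simp add: field_simps)
  have "norm (exp (2 * of_real pi * \<i> * of_nat n ^ 2 * of_real \<alpha>)) = 1" for n
  proof -
    have "2 * of_real pi * \<i> * of_nat n ^ 2 * of_real \<alpha>
        = \<i> * of_real (2 * pi * real n ^ 2 * \<alpha>)"
      by simp
    then show ?thesis
      by (simp only: norm_exp_i_times)
  qed
  then show "\<exists>N. \<forall>n\<ge>N. norm (exp (2 * of_real pi * \<i> * of_nat n ^ 2 * of_real \<alpha>) * (z ^ n / fact n))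
      \<le> norm z ^ n / fact n"
    by (simp add: norm_mult norm_divide norm_power)
qed

text \<open>The supremum is a maximum for continuous functions, see \<open>max_modulus_attained\<close>.\<close>

definition max_modulus :: "real \<Rightarrow> (complex \<Rightarrow> complex) \<Rightarrow> real" where
  "max_modulus r f = (SUP z\<in>sphere 0 r. norm (f z))"

lemma max_modulus_attained:
  assumes "continuous_on (sphere 0 r) f" and "r > 0"
  shows "\<exists>z\<in>sphere 0 r. norm (f z) = max_modulus r f
           \<and> (\<forall>w\<in>sphere 0 r. norm (f w) \<le> norm (f z))"
proof -
  have "compact (sphere (0::complex) r)" "sphere (0::complex) r \<noteq> {}"
    using \<open>r > 0\<close> by auto
  moreover have "continuous_on (sphere 0 r) (\<lambda>z. norm (f z))"
    using assms(1) by (intro continuous_intros)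
  ultimately obtain z where z: "z \<in> sphere 0 r" "\<forall>w\<in>sphere 0 r. norm (f w) \<le> norm (f z)"
    using continuous_attains_sup by blast
  then have "max_modulus r f = norm (f z)"
    unfolding max_modulus_def by (intro cSup_eq_maximum) auto
  with z show ?thesis
    by auto
qed

definition quadratic_mean :: "real \<Rightarrow> (complex \<Rightarrow> complex) \<Rightarrow> real" where
  "quadratic_mean r f =
     sqrt (1 / (2 * pi) * integral {-pi..pi} (\<lambda>\<theta>. (norm (f (of_real r * exp (\<i> * of_real \<theta>))))\<^sup>2))"

text \<open>Residual sets relative to \<open>S\<close> are literally countable intersections of relatively open
  dense sets; supersets of such sets are not included.\<close>

definition residual_in :: "'a::topological_space set \<Rightarrow> 'a set \<Rightarrow> bool" where
  "residual_in S E \<longleftrightarrow>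
     (\<exists>U :: nat \<Rightarrow> 'a set.
        (\<forall>n. openin (top_of_set S) (U n) \<and> S \<subseteq> closure (U n)) \<and> E = (\<Inter>n. U n))"

end

theory Submission
  imports Defs
begin

text \<open>
  By Parseval, \<open>m\<^sub>2(r)\<^sup>2\<close> is the sum of the squares of \<open>T\<^sub>n = r\<^sup>n/n!\<close>, whatever \<open>\<alpha>\<close> is. Hence the set
  \<open>U\<^sub>K\<close> of all \<open>\<alpha>\<close> for which \<open>|f\<^sub>\<alpha>(z)| > K m\<^sub>2(|z|)\<close> for some \<open>z\<close> with \<open>|z| > K\<close> is relatively open,
  because \<open>f\<^sub>\<alpha>(z)\<close> is continuous in \<open>\<alpha>\<close>, and the limsup is infinite on the intersection of the \<open>U\<^sub>K\<close>.

  It remains to see that every rational \<open>\<alpha> = p/q\<close> lies in \<open>U\<^sub>K\<close>. Averaging \<open>f\<^sub>\<alpha>\<close> over the \<open>q\<close>-th roots of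
  unity times \<open>r\<close> leaves only the terms with \<open>q\<close> dividing \<open>n\<close>, whose coefficients are \<open>1\<close>; so the maximum
  modulus is at least the sum of the \<open>T\<^sub>n\<close> with \<open>q\<close> dividing \<open>n\<close>. As \<open>T\<^sub>n\<close> increases up to \<open>n = r\<close> and
  then decreases, this sum is at least \<open>e\<^sup>r/(2q)\<close> when \<open>r = R\<close> is a multiple of \<open>q\<close>. On the other hand
  \<open>m\<^sub>2(R)\<^sup>2\<close> is at most \<open>T\<^sub>R e\<^sup>R\<close>, and \<open>T\<^sub>R = o(e\<^sup>R)\<close> since many terms near \<open>n = R\<close> are almost as large
  as \<open>T\<^sub>R\<close>.
\<close>

section \<open>Uniform convergence of the series and continuity\<close>

lemma norm_f_alpha_coeff [simp]:
  "norm (exp (2 * of_real pi * \<i> * of_nat n ^ 2 * of_real \<alpha>)) = 1"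
proof -
  have "2 * of_real pi * \<i> * of_nat n ^ 2 * of_real \<alpha> = \<i> * of_real (2 * pi * real n ^ 2 * \<alpha>)"
    by simp
  then show ?thesis
    by (simp only: norm_exp_i_times)
qed

text \<open>The majorant \<open>r ^ n / fact n\<close> does not see the phases. Letting both
  arguments depend on \<open>x\<close> serves continuity in \<open>\<alpha>\<close> for fixed
  \<open>z\<close> as well as integration along a circle.\<close>

lemma f_alpha_uniform_limit:
  assumes "\<And>x. x \<in> S \<Longrightarrow> norm (z x) \<le> r"
  shows "uniform_limit S
           (\<lambda>N x. \<Sum>n<N. exp (2 * of_real pi * \<i> * of_nat n ^ 2 * of_real (a x)) * (z x ^ n / fact n))
           (\<lambda>x. f_alpha (a x) (z x)) sequentially"
  unfolding f_alpha_def
proof (rule Weierstrass_m_test)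
  show "summable (\<lambda>n. r ^ n / fact n)"
    using summable_exp[of r] by (simp add: field_simps)
  show "norm (exp (2 * of_real pi * \<i> * of_nat n ^ 2 * of_real (a x)) * (z x ^ n / fact n)) \<le> r ^ n / fact n"
    if "x \<in> S" for n x
    using assms[OF that] by (simp add: norm_mult norm_divide norm_power divide_right_mono power_mono)
qed

lemma continuous_on_f_alpha:
  assumes "continuous_on S a" "continuous_on S z" "\<And>x. x \<in> S \<Longrightarrow> norm (z x) \<le> r"
  shows "continuous_on S (\<lambda>x. f_alpha (a x) (z x))"
  by (rule uniform_limit_theorem[OF _ f_alpha_uniform_limit[of S z r a]])
     (use assms in \<open>auto intro!: continuous_intros always_eventually\<close>)

section \<open>Parseval's identity for polynomials on the unit circle\<close>

lemma has_integral_exp_circle: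
  assumes "k \<noteq> (0::int)"
  shows "((\<lambda>\<theta>. exp (\<i> * of_int k * of_real \<theta>)) has_integral 0) {-pi..pi}"
proof -
  have "((\<lambda>\<theta>. exp (\<i> * of_int k * of_real \<theta>)) has_integral
          exp (\<i> * of_int k * of_real pi) / (\<i> * of_int k)
        - exp (\<i> * of_int k * of_real (-pi)) / (\<i> * of_int k)) {-pi..pi}"
  proof (rule fundamental_theorem_of_calculus)
    fix x assume "x \<in> {-pi..pi}"
    have "((\<lambda>z. exp (\<i> * of_int k * z) / (\<i> * of_int k)) has_field_derivative
             exp (\<i> * of_int k * of_real x)) (at (of_real x))"
      using assms by (auto intro!: derivative_eq_intros)
    then show "((\<lambda>\<theta>. exp (\<i> * of_int k * of_real \<theta>) / (\<i> * of_int k)) has_vector_derivative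
             exp (\<i> * of_int k * of_real x)) (at x within {-pi..pi})"
      by (rule has_vector_derivative_real_field)
  qed simp
  moreover have "exp (\<i> * of_int k * of_real pi) = exp (\<i> * of_int k * of_real (-pi))"
    by (rule exp_eq[THEN iffD2]) (auto intro!: exI[of _ k] simp: algebra_simps)
  ultimately show ?thesis
    by simp
qed

text \<open>Adding the term of index \<open>N\<close> contributes its own square and a cross term.
  The latter combines exponentials of frequency \<open>n - N\<close> with \<open>n < N\<close>,
  never zero, so its integral vanishes.\<close>

lemma finite_parseval:
  fixes c :: "nat \<Rightarrow> complex"
  shows "((\<lambda>\<theta>. (norm (\<Sum>n<N. c n * exp (\<i> * of_real \<theta>) ^ n))\<^sup>2) has_integral
           2 * pi * (\<Sum>n<N. (norm (c n))\<^sup>2)) {-pi..pi}"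
proof (induction N)
  case 0
  then show ?case by simp
next
  case (Suc N)
  have split: "(norm (u + v))\<^sup>2 = (norm u)\<^sup>2 + (norm v)\<^sup>2 + 2 * Re (u * cnj v)" for u v :: complex
    unfolding cmod_power2 by (simp add: power2_eq_square algebra_simps)
  have exp_pow: "exp (\<i> * of_real \<theta>) ^ n * cnj (exp (\<i> * of_real \<theta>) ^ N)
      = exp (\<i> * of_int (int n - int N) * of_real \<theta>)" for n \<theta>
    by (simp add: exp_of_nat_mult [symmetric] exp_cnj exp_add [symmetric] algebra_simps)
  have "((\<lambda>\<theta>. \<Sum>n<N. c n * cnj (c N) * exp (\<i> * of_int (int n - int N) * of_real \<theta>))
          has_integral (\<Sum>n<N. c n * cnj (c N) * 0)) {-pi..pi}"
    by (intro has_integral_sum has_integral_mult_right has_integral_exp_circle) auto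
  also have "(\<lambda>\<theta>. \<Sum>n<N. c n * cnj (c N) * exp (\<i> * of_int (int n - int N) * of_real \<theta>)) =
     (\<lambda>\<theta>. (\<Sum>n<N. c n * exp (\<i> * of_real \<theta>) ^ n) * cnj (c N * exp (\<i> * of_real \<theta>) ^ N))"
    unfolding exp_pow [symmetric] by (auto simp: sum_distrib_left sum_distrib_right mult_ac)
  finally have "((\<lambda>\<theta>. (\<Sum>n<N. c n * exp (\<i> * of_real \<theta>) ^ n) * cnj (c N * exp (\<i> * of_real \<theta>) ^ N))
          has_integral 0) {-pi..pi}"
    by simp
  from has_integral_mult_right[OF has_integral_Re[OF this], of 2]
  have "((\<lambda>\<theta>. 2 * Re ((\<Sum>n<N. c n * exp (\<i> * of_real \<theta>) ^ n) * cnj (c N * exp (\<i> * of_real \<theta>) ^ N)))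
          has_integral 2 * 0) {-pi..pi}"
    by simp
  moreover have "((\<lambda>\<theta>. (norm (c N))\<^sup>2) has_integral 2 * pi * (norm (c N))\<^sup>2) {-pi..pi}"
    using has_integral_const_real[of "(norm (c N))\<^sup>2" "-pi" pi] by simp
  ultimately have "((\<lambda>\<theta>. (norm (\<Sum>n<N. c n * exp (\<i> * of_real \<theta>) ^ n))\<^sup>2 + (norm (c N))\<^sup>2
      + 2 * Re ((\<Sum>n<N. c n * exp (\<i> * of_real \<theta>) ^ n) * cnj (c N * exp (\<i> * of_real \<theta>) ^ N)))
      has_integral 2 * pi * (\<Sum>n<N. (norm (c n))\<^sup>2) + 2 * pi * (norm (c N))\<^sup>2 + 2 * 0) {-pi..pi}"
    using Suc.IH by (intro has_integral_add)
  then show ?case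
    by (simp only: sum.lessThan_Suc split norm_mult norm_power norm_exp_i_times power_one
        mult_1_right mult_zero_right add_0_right distrib_left)
qed

section \<open>Shape and size of the terms of the exponential series\<close>

lemma exp_terms_sums: "(\<lambda>n. (r::real) ^ n / fact n) sums exp r"
  using exp_converges[of r] by (simp add: field_simps)

text \<open>The ratio of consecutive terms is \<open>r / Suc m\<close>, which is at least 1 as long
  as \<open>Suc m\<close> does not exceed \<open>r\<close>.\<close>

lemma exp_term_mono:
  assumes "n \<le> m" "real m \<le> r"
  shows "r ^ n / fact n \<le> r ^ m / fact m"
  using assms
proof (induction m rule: dec_induct)
  case (step m)
  have "r ^ m / fact m * 1 \<le> r ^ m / fact m * (r / real (Suc m))"
    using step by (intro mult_left_mono) auto
  then have "r ^ m / fact m \<le> r ^ Suc m / fact (Suc m)"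
    by (simp add: mult_ac)
  with step show ?case
    by simp
qed simp

lemma exp_term_antimono:
  assumes "n \<le> m" "r \<le> real n" "0 \<le> r"
  shows "r ^ m / fact m \<le> r ^ n / fact n"
  using assms(1)
proof (induction m rule: dec_induct)
  case (step m)
  have "r ^ m / fact m * (r / real (Suc m)) \<le> r ^ m / fact m * 1"
    using step assms by (intro mult_left_mono) auto
  then have "r ^ Suc m / fact (Suc m) \<le> r ^ m / fact m"
    by (simp add: mult_ac)
  with step show ?case
    by simp
qed simp

lemma exp_term_le_max: "real R ^ n / fact n \<le> real R ^ R / fact R"
  by (cases "n \<le> R") (auto intro: exp_term_mono exp_term_antimono)

text \<open>A quadratic lower bound for the decay just beyond the peak: terms at distance of order
  \<open>sqrt R\<close> from it are still comparable with the largest one.\<close>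

lemma exp_term_shift_ge:
  assumes "R > 0"
  shows "real R ^ R / fact R * (1 - real j ^ 2 / real R) \<le> real R ^ (R + j) / fact (R + j)"
proof (induction j)
  case (Suc j)
  \<comment> \<open>The right side exceeds the left by exactly
    \<open>R * j + (j + 1) ^ 3\<close>.\<close>
  have "real R * real R - real R * (real j + 1)\<^sup>2 + (real R * (real j + 1) - (real j + 1) ^ 3)
      \<le> real R * (real R - real j ^ 2)"
    by (simp add: algebra_simps power2_eq_square power3_eq_cube)
  then have "(real R - (real j + 1) ^ 2) * (real R + real j + 1) \<le> real R * (real R - real j ^ 2)"
    by (simp add: algebra_simps power2_eq_square power3_eq_cube)
  then have "(real R - (real j + 1) ^ 2) / real R \<le> (real R - real j ^ 2) / (real R + real j + 1)"
    using assms by (simp add: pos_divide_le_eq pos_le_divide_eq mult.commute)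
  also have "(real R - (real j + 1) ^ 2) / real R = 1 - real (Suc j) ^ 2 / real R"
    using assms by (simp add: diff_divide_distrib add.commute)
  also have "(real R - real j ^ 2) / (real R + real j + 1) = (1 - real j ^ 2 / real R) * (real R / real (Suc (R + j)))"
    using assms by (simp add: left_diff_distrib diff_divide_distrib add_ac)
  finally have "1 - real (Suc j) ^ 2 / real R \<le> (1 - real j ^ 2 / real R) * (real R / real (Suc (R + j)))" .
  then have "real R ^ R / fact R * (1 - real (Suc j) ^ 2 / real R)
     \<le> real R ^ R / fact R * ((1 - real j ^ 2 / real R) * (real R / real (Suc (R + j))))"
    by (intro mult_left_mono) auto
  also have "\<dots> = (real R ^ R / fact R * (1 - real j ^ 2 / real R)) * (real R / real (Suc (R + j)))"
    by simp
  also have "\<dots> \<le> (real R ^ (R + j) / fact (R + j)) * (real R / real (Suc (R + j)))"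
    by (intro mult_right_mono Suc) auto
  finally show ?case
    by (simp add: mult_ac)
qed simp

text \<open>Each of the \<open>J\<close> terms from index \<open>R\<close> on is at least half the
  largest term, since \<open>j < J\<close> gives \<open>j\<^sup>2 / R \<le> 1/2\<close>. This
  quantifies that the largest term is small against \<open>exp R\<close>.\<close>

lemma exp_ge_multiple_of_max_term:
  assumes "R > 0" "2 * J\<^sup>2 \<le> R"
  shows "real J / 2 * (real R ^ R / fact R) \<le> exp (real R)"
proof -
  have "real R ^ R / fact R * (1/2) \<le> real R ^ (R + j) / fact (R + j)" if "j < J" for j
  proof -
    have "j\<^sup>2 \<le> J\<^sup>2"
      using that by simp
    then have "2 * j\<^sup>2 \<le> R"
      using assms by linarith
    then have "2 * real j ^ 2 \<le> real R"
      by (metis of_nat_le_iff of_nat_mult of_nat_numeral of_nat_power)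
    then have "1/2 \<le> 1 - real j ^ 2 / real R"
      using assms by (simp add: field_simps)
    then have "real R ^ R / fact R * (1/2) \<le> real R ^ R / fact R * (1 - real j ^ 2 / real R)"
      by (intro mult_left_mono) auto
    also have "\<dots> \<le> real R ^ (R + j) / fact (R + j)"
      by (rule exp_term_shift_ge) fact
    finally show ?thesis .
  qed
  then have "(\<Sum>j<J. real R ^ R / fact R * (1/2)) \<le> (\<Sum>j<J. real R ^ (R + j) / fact (R + j))"
    by (intro sum_mono) auto
  also have "\<dots> = (\<Sum>n\<in>(+) R ` {..<J}. real R ^ n / fact n)"
    by (subst sum.reindex) auto
  also have "\<dots> \<le> (\<Sum>n. real R ^ n / fact n)"
    using exp_terms_sums[of "real R"] by (intro sum_le_suminf) (auto simp: sums_iff)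
  also have "\<dots> = exp (real R)"
    using exp_terms_sums[of "real R"] by (simp add: sums_iff)
  finally show ?thesis
    by simp
qed

section \<open>The quadratic mean as a series\<close>

lemma summable_exp_term_squares: "summable (\<lambda>n. ((r::real) ^ n / fact n)\<^sup>2)"
proof (rule summable_comparison_test)
  show "summable (\<lambda>n. (r\<^sup>2) ^ n / fact n)"
    using exp_terms_sums by (rule sums_summable)
  have "(r\<^sup>2) ^ n / fact n / fact n \<le> (r\<^sup>2) ^ n / fact n / (1::real)" for n
    by (intro divide_left_mono) (auto simp: fact_ge_1)
  then show "\<exists>N. \<forall>n\<ge>N. norm ((r ^ n / fact n)\<^sup>2) \<le> (r\<^sup>2) ^ n / fact n"
    by (auto simp: power_divide power2_eq_square power_mult_distrib)
qed

text \<open>Parseval for the partial sums passes to the limit by uniform convergence. The phases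
  have modulus 1, so \<open>\<alpha>\<close> disappears.\<close>

lemma quadratic_mean_f_alpha:
  assumes "r > 0"
  shows "quadratic_mean r (f_alpha \<alpha>) = sqrt (\<Sum>n. (r ^ n / fact n)\<^sup>2)"
proof -
  define c where "c n = exp (2 * of_real pi * \<i> * of_nat n ^ 2 * of_real \<alpha>) * (of_real r ^ n / fact n)" for n
  define p where "p N \<theta> = (\<Sum>n<N. c n * exp (\<i> * of_real \<theta>) ^ n)" for N \<theta>
  define f where "f \<theta> = f_alpha \<alpha> (of_real r * exp (\<i> * of_real \<theta>))" for \<theta>
  have norm_c: "norm (c n) = r ^ n / fact n" for n
    using assms by (simp add: c_def norm_mult norm_divide norm_power)
  have lim: "uniform_limit {-pi..pi} p f sequentially"
  proof -
    have "uniform_limit {-pi..pi} (\<lambda>N \<theta>. \<Sum>n<N. exp (2 * of_real pi * \<i> * of_nat n ^ 2 * of_real \<alpha>)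
             * ((of_real r * exp (\<i> * of_real \<theta>)) ^ n / fact n)) f sequentially"
      unfolding f_def using assms
      by (intro f_alpha_uniform_limit[where r = r]) (simp add: norm_mult)
    then show ?thesis
      by (simp add: p_def [abs_def] c_def power_mult_distrib mult_ac)
  qed
  have cont: "continuous_on {-pi..pi} f"
    unfolding f_def using assms
    by (intro continuous_on_f_alpha[where r = r]) (auto intro!: continuous_intros simp: norm_mult)
  \<comment> \<open>Boundedness of the limit lets uniform convergence survive squaring.\<close>
  have bdd: "bounded ((\<lambda>\<theta>. norm (f \<theta>)) ` {-pi..pi})"
    by (intro compact_imp_bounded compact_continuous_image continuous_intros cont) auto
  have "uniform_limit {-pi..pi} (\<lambda>N \<theta>. norm (p N \<theta>)) (\<lambda>\<theta>. norm (f \<theta>)) sequentially"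
    by (intro uniform_limit_norm lim)
  from uniform_lim_mult[OF this this bdd bdd]
  have "uniform_limit {-pi..pi} (\<lambda>N \<theta>. (norm (p N \<theta>))\<^sup>2) (\<lambda>\<theta>. (norm (f \<theta>))\<^sup>2) sequentially"
    by (simp add: power2_eq_square)
  then obtain I J where IJ: "\<And>N. ((\<lambda>\<theta>. (norm (p N \<theta>))\<^sup>2) has_integral I N) {-pi..pi}"
    "((\<lambda>\<theta>. (norm (f \<theta>))\<^sup>2) has_integral J) {-pi..pi}" "I \<longlonglongrightarrow> J"
    by (rule uniform_limit_integral) (auto simp: p_def intro!: continuous_intros)
  have "I N = 2 * pi * (\<Sum>n<N. (r ^ n / fact n)\<^sup>2)" for N
    using has_integral_unique[OF IJ(1)[of N, unfolded p_def] finite_parseval] by (simp add: norm_c)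
  then have "I = (\<lambda>N. 2 * pi * (\<Sum>n<N. (r ^ n / fact n)\<^sup>2))"
    by blast
  then have "I \<longlonglongrightarrow> 2 * pi * (\<Sum>n. (r ^ n / fact n)\<^sup>2)"
    by (simp only:) (intro tendsto_intros summable_LIMSEQ summable_exp_term_squares)
  with IJ(3) have "J = 2 * pi * (\<Sum>n. (r ^ n / fact n)\<^sup>2)"
    by (metis LIMSEQ_unique)
  with IJ(2) show ?thesis
    by (simp add: quadratic_mean_def f_def integral_unique)
qed

lemma suminf_exp_term_squares_pos:
  assumes "r > 0"
  shows "(\<Sum>n. ((r::real) ^ n / fact n)\<^sup>2) > 0"
  using assms by (intro suminf_pos summable_exp_term_squares) auto

text \<open>In each square, one factor is bounded by the largest term; the other factors sum to
  \<open>exp R\<close>.\<close>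

lemma suminf_exp_term_squares_le:
  "(\<Sum>n. (real R ^ n / fact n)\<^sup>2) \<le> real R ^ R / fact R * exp (real R)"
proof -
  have s: "(\<lambda>n. real R ^ R / fact R * (real R ^ n / fact n)) sums (real R ^ R / fact R * exp (real R))"
    by (intro sums_mult exp_terms_sums)
  have "(\<Sum>n. (real R ^ n / fact n)\<^sup>2) \<le> (\<Sum>n. real R ^ R / fact R * (real R ^ n / fact n))"
    using s unfolding power2_eq_square
    by (intro suminf_le summable_exp_term_squares[unfolded power2_eq_square] mult_right_mono exp_term_le_max)
       (auto simp: sums_iff)
  with s show ?thesis
    by (simp add: sums_iff)
qed

section \<open>Sums over the multiples of \<open>q\<close> and averages over roots of unity\<close>

text \<open>The full series is cut into blocks of length \<open>q\<close>. Each block is at most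
  \<open>q\<close> times the sum of the terms at its two ends, and every multiple of
  \<open>q\<close> is an end of at most two blocks.\<close>

lemma exp_le_section:
  assumes "q > 0" "q dvd R" and s: "(\<lambda>m. real R ^ (q * m) / fact (q * m)) sums S"
  shows "exp (real R) \<le> 2 * real q * S"
proof -
  define T where "T n = real R ^ n / fact n" for n
  have T_nonneg: "T n \<ge> 0" for n
    by (simp add: T_def)
  have s0: "(\<lambda>m. T (q * m)) sums S"
    using s by (simp add: T_def)
  then have s1: "(\<lambda>m. T (q * Suc m)) sums (S - T 0)"
    by (subst sums_Suc_iff) simp
  have block: "sum T {m * q ..< m * q + q} \<le> real q * (T (q * m) + T (q * Suc m))" for m
  proof -
    \<comment> \<open>Since \<open>q\<close> divides \<open>R\<close>, the peak is not interior to a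
      block. So \<open>T\<close> decreases from the left end or increases up to the right
      end.\<close>
    have "T n \<le> T (q * m) + T (q * Suc m)" if n: "n \<in> {m * q ..< m * q + q}" for n
    proof (cases "R \<le> q * m")
      case True
      with n have "T n \<le> T (q * m)"
        unfolding T_def by (intro exp_term_antimono) (auto simp: mult_ac simp flip: of_nat_mult)
      with T_nonneg[of "q * Suc m"] show ?thesis
        by linarith
    next
      case False
      obtain k where k: "R = q * k"
        using \<open>q dvd R\<close> by blast
      with False have "Suc m \<le> k"
        by auto
      then have "q * Suc m \<le> R"
        unfolding k by (rule mult_le_mono2)
      with n have "T n \<le> T (q * Suc m)"
        unfolding T_def by (intro exp_term_mono) (auto simp: mult_ac simp flip: of_nat_mult of_nat_Suc of_nat_add)
      with T_nonneg[of "q * m"] show ?thesis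
        by linarith
    qed
    then have "sum T {m * q ..< m * q + q} \<le> of_nat (card {m * q ..< m * q + q}) * (T (q * m) + T (q * Suc m))"
      by (rule sum_bounded_above)
    then show ?thesis
      by simp
  qed
  have "(\<lambda>m. sum T {m * q ..< m * q + q}) sums exp (real R)"
    using exp_terms_sums assms(1) unfolding T_def by (intro sums_group)
  moreover have "(\<lambda>m. real q * (T (q * m) + T (q * Suc m))) sums (real q * (S + (S - T 0)))"
    by (intro sums_mult sums_add s0 s1)
  ultimately have "exp (real R) \<le> real q * (S + (S - T 0))"
    using block by (rule sums_le[rotated 1])
  also have "\<dots> \<le> real q * (S + S)"
    using T_nonneg[of 0] by (intro mult_left_mono) auto
  finally show ?thesis
    by simp
qed

text \<open>This is a geometric sum with ratio \<open>w ^ n\<close>, a \<open>q\<close>-th root of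
  unity that equals 1 exactly when \<open>q\<close> divides \<open>n\<close>.\<close>

lemma sum_roots_of_unity_power:
  assumes "q > 0"
  defines "w \<equiv> exp (2 * of_real pi * \<i> / of_nat q)"
  shows "(\<Sum>k<q. (w ^ k) ^ n) = (if q dvd n then of_nat q else 0)"
proof -
  have w: "w ^ n = exp (2 * of_real pi * \<i> * of_nat n / of_nat q)" for n
    by (simp add: w_def exp_of_nat_mult [symmetric] mult_ac)
  have eq: "(\<Sum>k<q. (w ^ k) ^ n) = (\<Sum>k<q. (w ^ n) ^ k)"
    by (simp add: power_mult [symmetric] mult.commute)
  have iff: "w ^ n = 1 \<longleftrightarrow> q dvd n"
    unfolding w using assms by (intro complex_root_unity_eq_1) auto
  have "w ^ q = 1"
    unfolding w using assms by (simp add: exp_eq_1)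
  then have "(w ^ n) ^ q = 1"
    by (metis power_mult mult.commute power_one)
  then show ?thesis
    unfolding eq using iff by (auto simp: sum_gp_strict)
qed

text \<open>The average of \<open>f_alpha \<alpha>\<close> over the points \<open>r * w ^ k\<close>
  equals \<open>S\<close>, so the modulus cannot be below \<open>S\<close> at all of them.\<close>

lemma f_alpha_section_le:
  assumes "q > 0" "\<alpha> = of_nat p / of_nat q" "r > 0"
    and s: "(\<lambda>m. r ^ (q * m) / fact (q * m)) sums S"
  shows "\<exists>z. norm z = r \<and> S \<le> norm (f_alpha \<alpha> z)"
proof (rule ccontr)
  assume "\<not> ?thesis"
  then have less: "norm (f_alpha \<alpha> z) < S" if "norm z = r" for z
    using that by force
  define w where "w = exp (2 * of_real pi * \<i> / of_nat q)"
  have norm_w: "norm w = 1"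
    by (simp add: w_def norm_exp_eq_Re)
  define c where "c n = exp (2 * of_real pi * \<i> * of_nat n ^ 2 * of_real \<alpha>)" for n
  have c_mult: "c (q * m) = 1" for m
  proof -
    \<comment> \<open>For \<open>n = q * m\<close> the phase \<open>n\<^sup>2 * p / q\<close> is an
      integer.\<close>
    have "(of_nat (q * m))\<^sup>2 * complex_of_real \<alpha> = of_nat (q * m\<^sup>2 * p)"
      using assms(1) by (simp add: assms(2) power2_eq_square)
    then have "2 * of_real pi * \<i> * of_nat (q * m) ^ 2 * of_real \<alpha> = 2 * of_real pi * \<i> * of_nat (q * m\<^sup>2 * p)"
      by (simp only: mult.assoc)
    moreover have "exp (2 * of_real pi * \<i> * of_nat (q * m\<^sup>2 * p)) = 1"
      using complex_root_unity_eq_1[of 1 "q * m\<^sup>2 * p"] by simp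
    ultimately show ?thesis
      by (simp only: c_def)
  qed
  have "(\<lambda>n. c n * ((of_real r * w ^ k) ^ n / fact n)) sums f_alpha \<alpha> (of_real r * w ^ k)" for k
    unfolding f_alpha_def c_def by (rule summable_sums[OF summable_f_alpha])
  then have "(\<lambda>n. \<Sum>k<q. c n * ((of_real r * w ^ k) ^ n / fact n)) sums (\<Sum>k<q. f_alpha \<alpha> (of_real r * w ^ k))"
    by (rule sums_sum)
  also have "(\<lambda>n. \<Sum>k<q. c n * ((of_real r * w ^ k) ^ n / fact n)) =
      (\<lambda>n. c n * (of_real r ^ n / fact n) * (if q dvd n then of_nat q else 0))"
    unfolding sum_roots_of_unity_power[OF assms(1), folded w_def, symmetric] sum_distrib_left
    by (simp add: power_mult_distrib mult_ac)
  \<comment> \<open>Restricting to the indices \<open>q * m\<close> drops only vanishing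
    terms.\<close>
  finally have "(\<lambda>m. c (q * m) * (of_real r ^ (q * m) / fact (q * m)) * (if q dvd q * m then of_nat q else 0))
      sums (\<Sum>k<q. f_alpha \<alpha> (of_real r * w ^ k))"
    using assms(1) by (subst sums_mono_reindex[where g = "\<lambda>m. q * m"]) (auto simp: strict_mono_def)
  then have "(\<lambda>m. complex_of_real (r ^ (q * m) / fact (q * m) * real q)) sums (\<Sum>k<q. f_alpha \<alpha> (of_real r * w ^ k))"
    by (simp add: c_mult)
  moreover have "(\<lambda>m. complex_of_real (r ^ (q * m) / fact (q * m) * real q)) sums of_real (S * real q)"
    by (intro sums_of_real sums_mult2 s)
  ultimately have avg: "(\<Sum>k<q. f_alpha \<alpha> (of_real r * w ^ k)) = of_real (S * real q)"
    by (rule sums_unique2)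
  have "S * real q \<le> norm (\<Sum>k<q. f_alpha \<alpha> (of_real r * w ^ k))"
    unfolding avg norm_of_real by (rule abs_ge_self)
  also have "\<dots> \<le> (\<Sum>k<q. norm (f_alpha \<alpha> (of_real r * w ^ k)))"
    by (rule norm_sum)
  also have "\<dots> < (\<Sum>k<q. S)"
    using assms norm_w by (intro sum_strict_mono less) (auto simp: norm_mult norm_power)
  finally show False
    by simp
qed

section \<open>Large values at rational parameters\<close>

lemma f_alpha_rational_large:
  assumes "q > 0" "\<alpha> = of_nat p / of_nat q" "K \<ge> 0"
  shows "\<exists>z. norm z > K \<and> norm (f_alpha \<alpha> z) > K * sqrt (\<Sum>n. (norm z ^ n / fact n)\<^sup>2)"
proof -
  \<comment> \<open>This makes the square of \<open>2 * q * (K + 1)\<close> at most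
    \<open>J / 2\<close>, the factor in \<open>exp_ge_multiple_of_max_term\<close>. Using
    \<open>K + 1\<close> in place of \<open>K\<close> yields a strict inequality at the end.\<close>
  obtain J :: nat where J: "2 * (2 * real q * (K + 1))\<^sup>2 \<le> real J"
    using real_arch_simple by blast
  obtain L :: nat where L: "K < real L"
    using reals_Archimedean2 by blast
  \<comment> \<open>The factor \<open>q\<close> puts the peak on a multiple of \<open>q\<close>; the
    summand \<open>L\<close> forces \<open>R > K\<close>, and the other one gives
    \<open>2 * J\<^sup>2 \<le> R\<close>.\<close>
  define R where "R = q * (L + 2 * J\<^sup>2)"
  have "1 * (L + 2 * J\<^sup>2) \<le> R"
    unfolding R_def using assms(1) by (intro mult_le_mono1) auto
  then have R: "2 * J\<^sup>2 \<le> R" "L \<le> R"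
    by auto
  have "K < real R"
    using L R by linarith
  then have "R > 0"
    using assms(3) by (cases R) auto
  define T where "T = real R ^ R / fact R"
  define Q where "Q = (\<Sum>n. (real R ^ n / fact n)\<^sup>2)"
  have "Q > 0"
    unfolding Q_def using \<open>R > 0\<close> by (intro suminf_exp_term_squares_pos) auto
  define S where "S = (\<Sum>m. real R ^ (q * m) / fact (q * m))"
  have "summable (\<lambda>m. real R ^ (q * m) / fact (q * m))"
  proof -
    have "summable (\<lambda>n. if q dvd n then real R ^ n / fact n else 0)"
      by (rule summable_comparison_test[OF _ sums_summable[OF exp_terms_sums[of "real R"]]]) auto
    then have "summable (\<lambda>m. if q dvd q * m then real R ^ (q * m) / fact (q * m) else 0)"
      using assms(1) by (subst summable_mono_reindex[where g = "\<lambda>m. q * m"]) (auto simp: strict_mono_def)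
    then show ?thesis
      by simp
  qed
  then have S: "(\<lambda>m. real R ^ (q * m) / fact (q * m)) sums S"
    by (simp add: S_def summable_sums)
  obtain z where z: "norm z = real R" "S \<le> norm (f_alpha \<alpha> z)"
    using f_alpha_section_le[OF assms(1,2) _ S] \<open>R > 0\<close> by auto
  have "T \<ge> 0"
    by (simp add: T_def)
  have "(2 * real q * (K + 1))\<^sup>2 * Q \<le> (2 * real q * (K + 1))\<^sup>2 * (T * exp (real R))"
    unfolding Q_def T_def by (intro mult_left_mono suminf_exp_term_squares_le) auto
  also have "\<dots> \<le> real J / 2 * (T * exp (real R))"
    using J \<open>T \<ge> 0\<close> by (intro mult_right_mono) auto
  also have "\<dots> = (real J / 2 * T) * exp (real R)"
    by simp
  also have "\<dots> \<le> exp (real R) * exp (real R)"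
    unfolding T_def using \<open>R > 0\<close> R by (intro mult_right_mono exp_ge_multiple_of_max_term) auto
  finally have "(2 * real q * (K + 1) * sqrt Q)\<^sup>2 \<le> (exp (real R))\<^sup>2"
    unfolding power_mult_distrib[of _ "sqrt Q"] using \<open>Q > 0\<close>
    by (simp add: power2_eq_square[of "exp (real R)"])
  then have "2 * real q * (K + 1) * sqrt Q \<le> exp (real R)"
    by (rule power2_le_imp_le) simp
  also have "\<dots> \<le> 2 * real q * S"
    using assms(1) S by (intro exp_le_section) (auto simp: R_def)
  finally have "(K + 1) * sqrt Q \<le> S"
    using assms(1) by (simp add: mult.assoc)
  moreover have "sqrt Q > 0"
    using \<open>Q > 0\<close> by simp
  ultimately have "K * sqrt Q < S"
    using \<open>(K + 1) * sqrt Q \<le> S\<close> unfolding distrib_right by linarith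
  with z \<open>K < real R\<close> show ?thesis
    by (intro exI[of _ z]) (auto simp: Q_def)
qed

section \<open>Density of the rationals and the residual set\<close>

lemma unit_interval_rational_closure:
  assumes "\<And>p q. q > 0 \<Longrightarrow> p \<le> q \<Longrightarrow> real p / real q \<in> U"
  shows "{0..1} \<subseteq> closure U"
proof
  fix x :: real assume x: "x \<in> {0..1}"
  show "x \<in> closure U"
    unfolding closure_approachable
  proof safe
    fix e :: real assume "e > 0"
    then obtain q where q: "q > 0" "inverse (real q) < e"
      using reals_Archimedean by (metis zero_less_Suc)
    \<comment> \<open>Rounding down keeps \<open>p / q\<close> within \<open>1 / q\<close> of
      \<open>x\<close> and, as \<open>x \<le> 1\<close>, inside the unit interval.\<close>
    define p where "p = nat \<lfloor>real q * x\<rfloor>"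
    have p: "real p \<le> real q * x" "real q * x < real p + 1"
      using x by (auto simp: p_def)
    have "real q * x \<le> real q * 1"
      using x by (intro mult_left_mono) auto
    with p have "p \<le> q"
      by linarith
    have "\<bar>real p / real q - x\<bar> = \<bar>(real p - real q * x) / real q\<bar>"
      using q by (simp add: diff_divide_distrib)
    also have "\<dots> \<le> 1 / real q"
      unfolding abs_divide using p by (intro divide_mono) (use q in auto)
    finally have "\<bar>real p / real q - x\<bar> \<le> inverse (real q)"
      by (simp add: inverse_eq_divide)
    with q have "dist (real p / real q) x < e"
      by (simp add: dist_real_def)
    with assms[OF q(1) \<open>p \<le> q\<close>] show "\<exists>y\<in>U. dist y x < e"
      by blast
  qed
qed

lemma norm_f_alpha_le_max_modulus: "norm (f_alpha \<alpha> z) \<le> max_modulus (norm z) (f_alpha \<alpha>)"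
  unfolding max_modulus_def
proof (rule cSUP_upper)
  have "continuous_on (sphere 0 (norm z)) (f_alpha \<alpha>)"
    by (rule continuous_on_f_alpha[where r = "norm z"]) (auto intro!: continuous_intros)
  then show "bdd_above ((\<lambda>w. norm (f_alpha \<alpha> w)) ` sphere 0 (norm z))"
    by (intro bounded_imp_bdd_above compact_imp_bounded compact_continuous_image continuous_intros) auto
qed simp

theorem theorem4:
  shows "\<exists>E. residual_in {0..1::real} E \<and>
           (\<forall>\<alpha>\<in>E. Limsup at_top
              (\<lambda>r. ereal (max_modulus r (f_alpha \<alpha>) / quadratic_mean r (f_alpha \<alpha>))) = \<infinity>)"
proof -
  \<comment> \<open>This is the quadratic mean shared by all \<open>f_alpha \<alpha>\<close>. Being
    constant in \<open>\<alpha>\<close>, it leaves only continuity of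
    \<open>f_alpha \<alpha> z\<close> in \<open>\<alpha>\<close> to check for openness.\<close>
  define m where "m r = sqrt (\<Sum>n. (r ^ n / fact n)\<^sup>2)" for r :: real
  \<comment> \<open>\<open>K\<close> bounds both the ratio and the radius from below, so membership
    for all \<open>K\<close> gives large ratios at arbitrarily large radii.\<close>
  define G where "G K = (\<Union>z\<in>{z. norm z > real K}. {\<alpha>. norm (f_alpha \<alpha> z) > real K * m (norm z)})" for K
  define U where "U K = {0..1} \<inter> G K" for K
  have "open (G K)" for K
    unfolding G_def
  proof (intro open_UN ballI)
    fix z :: complex
    have "continuous_on UNIV (\<lambda>\<alpha>. f_alpha \<alpha> z)"
      by (rule continuous_on_f_alpha[where r = "norm z"]) (auto intro!: continuous_intros)
    then show "open {\<alpha>. norm (f_alpha \<alpha> z) > real K * m (norm z)}"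
      by (intro open_Collect_less continuous_intros)
  qed
  then have "openin (top_of_set {0..1}) (U K)" for K
    unfolding U_def by (rule openin_open_Int)
  moreover have "{0..1} \<subseteq> closure (U K)" for K
  proof (rule unit_interval_rational_closure)
    fix p q :: nat assume "q > 0" "p \<le> q"
    then show "real p / real q \<in> U K"
      using f_alpha_rational_large[of q "real p / real q" p "real K"] by (auto simp: U_def G_def m_def)
  qed
  ultimately have "residual_in {0..1} (\<Inter>K. U K)"
    unfolding residual_in_def by (intro exI[of _ U] conjI allI refl)
  moreover have "Limsup at_top (\<lambda>r. ereal (max_modulus r (f_alpha \<alpha>) / quadratic_mean r (f_alpha \<alpha>))) = \<infinity>"
    if \<alpha>: "\<alpha> \<in> (\<Inter>K. U K)" for \<alpha>
  proof (rule ccontr)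
    assume "\<not> ?thesis"
    then obtain B :: nat where
      "Limsup at_top (\<lambda>r. ereal (max_modulus r (f_alpha \<alpha>) / quadratic_mean r (f_alpha \<alpha>))) < ereal (real B)"
      using less_PInf_Ex_of_nat by auto
    then have "\<forall>\<^sub>F r in at_top. ereal (max_modulus r (f_alpha \<alpha>) / quadratic_mean r (f_alpha \<alpha>)) < ereal (real B)"
      by (rule Limsup_lessD)
    then obtain r0 where r0: "\<And>r. r \<ge> r0 \<Longrightarrow> max_modulus r (f_alpha \<alpha>) / quadratic_mean r (f_alpha \<alpha>) < real B"
      by (auto simp: eventually_at_top_linorder)
    \<comment> \<open>One index beats the supposed bound \<open>B\<close> and also pushes the radius
      past \<open>r0\<close>.\<close>
    obtain K :: nat where K: "max (real B) r0 \<le> real K"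
      using real_arch_simple by blast
    obtain z where z: "norm z > real K" "norm (f_alpha \<alpha> z) > real K * m (norm z)"
      using \<alpha> by (auto simp: U_def G_def)
    have pos: "norm z > 0"
      using z(1) of_nat_0_le_iff[of K] by linarith
    then have "m (norm z) > 0"
      by (simp add: m_def suminf_exp_term_squares_pos)
    moreover have "real K * m (norm z) < max_modulus (norm z) (f_alpha \<alpha>)"
      using z(2) norm_f_alpha_le_max_modulus by (rule less_le_trans)
    ultimately have "real K < max_modulus (norm z) (f_alpha \<alpha>) / m (norm z)"
      by (simp add: field_simps)
    also have "\<dots> < real B"
      using r0[of "norm z"] z(1) K by (simp add: quadratic_mean_f_alpha[OF pos] m_def)
    finally show False
      using K by simp
  qed
  ultimately show ?thesis
    by blast
qed

end
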